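(* Let $n\ge 3$ be an integer, let $t_*=\tan\frac{\pi}{2n}$, and let $\mathsf{F}:[-t_*,t_*]\to[-t_*,t_*]$ be the piecewise fractional-linear transformation given, for $k=1,\dots,n-1$, by $$\mathsf{F}(t)=\frac{-b_{k,n}\,t+a_{k,n}\,t_*^2}{a_{k,n}\,t+b_{k,n}\,t_*^2}\qquad\text{for } t\in J_k=\left[t_*^2\cot\tfrac{\pi(2k+1)}{2n},\; t_*^2\cot\tfrac{\pi(2k-1)}{2n}\right],$$ where $a_{k,n}=\cos\frac{\pi k}{n}$ and $b_{k,n}=\sin\frac{\pi k}{n}$. Then the measure $\mu$ on $[-t_*,t_*]$ which is absolutely continuous with respect to Lebesgue measure with density $$\rho(t)=\frac{2t_*}{t_*^2-t^2}$$ is invariant under $\mathsf{F}$, i.e. $\mu(\mathsf{F}^{-1}(A))=\mu(A)$ for every Borel set $A\subset[-t_*,t_*]$.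
   Context: The intervals $J_1,\dots,J_{n-1}$ cover $[-t_*,t_*]$ and overlap only at common endpoints; the value of $\mathsf{F}$ at these finitely many common endpoints may be chosen according to either adjacent branch (this is a null set and does not matter for the statement). Equivalently, $\mathsf{F}=R_k\circ Q$ on $J_k=Q^{-1}\left(\left[\tan\frac{\pi(2k-1)}{2n},\tan\frac{\pi(2k+1)}{2n}\right]\right)$, where $Q(t)=t_*^2/t$ and $R_k(s)=\frac{a_{k,n}s-b_{k,n}}{b_{k,n}s+a_{k,n}}$, with intervals understood on the projective line $\mathbb{R}\cup\{\infty\}$ (so the interval contains $\infty$ if $2k=n$). Invariant measures are not required to be finite: $\mu$ is a $\sigma$-finite measure, possibly of infinite total mass. *)

theory Defs
  imports "HOL-Analysis.Analysis"
begin

definition t_star :: "nat \<Rightarrow> real" where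
  "t_star n = tan (pi / (2 * real n))"

definition a_coeff :: "nat \<Rightarrow> nat \<Rightarrow> real" where
  "a_coeff k n = cos (pi * real k / real n)"

definition b_coeff :: "nat \<Rightarrow> nat \<Rightarrow> real" where
  "b_coeff k n = sin (pi * real k / real n)"

definition J_interval :: "nat \<Rightarrow> nat \<Rightarrow> real set" where
  "J_interval n k =
     {(t_star n)\<^sup>2 * cot (pi * (2 * real k + 1) / (2 * real n)) ..
      (t_star n)\<^sup>2 * cot (pi * (2 * real k - 1) / (2 * real n))}"

definition F_branch :: "nat \<Rightarrow> nat \<Rightarrow> real \<Rightarrow> real" where
  "F_branch n k t =
     (- b_coeff k n * t + a_coeff k n * (t_star n)\<^sup>2) /
     (a_coeff k n * t + b_coeff k n * (t_star n)\<^sup>2)"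

text \<open>
  Adjacent intervals share an endpoint, where the two branches disagree. The map is
  therefore specified up to an arbitrary choice between the adjacent branches at each of
  these finitely many points; at every other point of the domain the index \<open>k\<close> below
  is unique. Values outside the domain are unconstrained.
\<close>

definition is_F_map :: "nat \<Rightarrow> (real \<Rightarrow> real) \<Rightarrow> bool" where
  "is_F_map n F \<longleftrightarrow>
     (\<forall>t\<in>{- t_star n .. t_star n}. \<exists>k\<in>{1..n - 1}. t \<in> J_interval n k \<and> F t = F_branch n k t)"

text \<open>Such maps exist, because the intervals cover the domain.\<close>

lemma ex_F_map:
  assumes "n \<ge> 3"
  shows "\<exists>F. is_F_map n F"
proof -
  define c where "c j = (t_star n)\<^sup>2 * cot (pi * (2 * real j + 1) / (2 * real n))" for j :: nat
  have range: "0 < pi / (2 * real n)" "pi / (2 * real n) < pi / 2"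
    using assms by (auto simp: field_simps)
  then have pos: "t_star n > 0"
    unfolding t_star_def by (intro tan_gt_zero)
  have tc: "(t_star n)\<^sup>2 * cot (pi / (2 * real n)) = t_star n"
    using pos by (simp add: t_star_def cot_def tan_def power2_eq_square)
  have c0: "c 0 = t_star n"
    using tc by (simp add: c_def)
  have "pi * (2 * real (n - 1) + 1) / (2 * real n) = pi - pi / (2 * real n)"
    using assms by (simp add: of_nat_diff field_simps)
  then have cn: "c (n - 1) = - t_star n"
    using tc by (simp add: c_def cot_def)
  have "\<exists>k\<in>{1..n - 1}. t \<in> J_interval n k" if t: "t \<in> {- t_star n .. t_star n}" for t
  proof -
    define k where "k = (LEAST j. j \<ge> 1 \<and> c j \<le> t)"
    have ex: "n - 1 \<ge> 1 \<and> c (n - 1) \<le> t"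
      using assms cn t by auto
    have k: "k \<ge> 1" "c k \<le> t" "k \<le> n - 1"
      using LeastI[where P = "\<lambda>j. j \<ge> 1 \<and> c j \<le> t", OF ex]
        Least_le[where P = "\<lambda>j. j \<ge> 1 \<and> c j \<le> t", OF ex]
      by (auto simp: k_def)
    have "t \<le> c (k - 1)"
    proof (cases "k = 1")
      case True
      then show ?thesis using c0 t by simp
    next
      case False
      have "\<not> (k - 1 \<ge> 1 \<and> c (k - 1) \<le> t)"
        using k(1) unfolding k_def by (intro not_less_Least) simp
      with False k(1) show ?thesis by linarith
    qed
    moreover have "2 * real (k - 1) + 1 = 2 * real k - 1"
      using k(1) by (simp add: of_nat_diff)
    ultimately have "t \<in> J_interval n k"
      using k(2) by (simp add: J_interval_def c_def)
    then show ?thesis using k by auto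
  qed
  then have "\<forall>t\<in>{- t_star n .. t_star n}. \<exists>y. \<exists>k\<in>{1..n - 1}. t \<in> J_interval n k \<and> y = F_branch n k t"
    by blast
  then show ?thesis
    unfolding is_F_map_def by (rule bchoice)
qed

definition rho :: "nat \<Rightarrow> real \<Rightarrow> real" where
  "rho n t = 2 * t_star n / ((t_star n)\<^sup>2 - t\<^sup>2)"

text \<open>At \<open>t = t_star n\<close> and \<open>t = - t_star n\<close> the value \<open>rho n t\<close> is
  \<open>0\<close> by the convention for division; elsewhere on the domain it is positive.\<close>

definition mu :: "nat \<Rightarrow> real measure" where
  "mu n = density (restrict_space lborel {- t_star n .. t_star n}) (\<lambda>t. ennreal (rho n t))"

text \<open>Measurability is part of the notion, since \<open>emeasure\<close> is \<open>0\<close> on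
  non-measurable sets; it also says that \<open>T\<close> maps the space of \<open>M\<close> into itself.
  The measure may be infinite, but has to be sigma-finite.\<close>

definition invariant_measure :: "'a measure \<Rightarrow> ('a \<Rightarrow> 'a) \<Rightarrow> bool" where
  "invariant_measure M T \<longleftrightarrow>
     sigma_finite_measure M \<and> T \<in> measurable M M \<and>
     (\<forall>A\<in>sets M. emeasure M (T -` A \<inter> space M) = emeasure M A)"

end

theory Submission imports Defs begin

text \<open>
  The coordinate \<open>ln ((t_star n + t) / (t_star n - t))\<close> has derivative \<open>rho n\<close>, so it carries
  \<open>mu n\<close> to Lebesgue measure on the whole line, and invariance only has to be checked on preimages of
  intervals. In the angular coordinate \<open>t = (t_star n)\<^sup>2 * cot x\<close> the \<open>k\<close>-th branch is
  \<open>tan (x - \<psi> k)\<close> with \<open>\<psi> k = 2 * k * \<tau>\<close> and \<open>t_star n = tan \<tau>\<close>. At the \<open>k\<close>-th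
  preimage of \<open>tan x\<close> the logarithmic coordinate is
  \<open>ln (sin (x + \<psi> k + \<tau>)) - ln (sin (x + \<psi> k - \<tau>))\<close>. The sum over \<open>k\<close> telescopes
  to minus the coordinate of \<open>tan x\<close>.
\<close>

section \<open>Logarithms with a common factor, and transfer of a measure to Lebesgue
  measure\<close>

lemma ln_mult_diff:
  fixes c x y :: real
  assumes "c > 0" "x > 0" "y > 0"
  shows "ln (c * x) - ln (c * y) = ln x - ln y"
  using assms by (simp add: ln_mult)

text \<open>The right-hand side does not depend on \<open>T\<close>, so invariance under \<open>F\<close> follows by applying
  this both to \<open>F\<close> and to the identity.\<close>

lemma emeasure_vimage_eq_lborel:
  fixes L :: "'a \<Rightarrow> real" and H :: "real \<Rightarrow> 'a"
  assumes T [measurable]: "T \<in> measurable M M"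
    and D [measurable]: "D \<in> sets M"
    and L [measurable]: "L \<in> borel_measurable (restrict_space M D)"
    and H [measurable]: "H \<in> measurable borel M"
    and HD: "\<And>x. H x \<in> D" and LH: "\<And>x. L (H x) = x"
    and HL: "\<And>y. y \<in> D \<Longrightarrow> H (L y) = y"
    and null: "T -` (space M - D) \<inter> space M \<in> null_sets M"
    and interval: "\<And>l u. l \<le> u \<Longrightarrow>
      emeasure M {x \<in> space M. T x \<in> D \<and> L (T x) \<in> {l<..<u}} = ennreal (u - l)"
    and A [measurable]: "A \<in> sets M"
  shows "emeasure M (T -` A \<inter> space M) = emeasure lborel (H -` A)"
proof -
  define X where "X = T -` D \<inter> space M"
  have X [measurable]: "X \<in> sets M" unfolding X_def by measurable
  have [measurable]: "T \<in> measurable (restrict_space M X) (restrict_space M D)"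
    by (rule measurable_restrict_space3) (auto simp: X_def)
  have LT [measurable]: "(\<lambda>x. L (T x)) \<in> borel_measurable (restrict_space M X)"
    by measurable
  define N where "N = distr (restrict_space M X) borel (\<lambda>x. L (T x))"
  have N: "emeasure N B = emeasure M {x \<in> space M. T x \<in> D \<and> L (T x) \<in> B}"
    if "B \<in> sets borel" for B
  proof -
    have "emeasure N B = emeasure M ((\<lambda>x. L (T x)) -` B \<inter> (X \<inter> space M))"
      using that by (simp add: N_def emeasure_distr space_restrict_space emeasure_restrict_space)
    also have "(\<lambda>x. L (T x)) -` B \<inter> (X \<inter> space M) = {x \<in> space M. T x \<in> D \<and> L (T x) \<in> B}"
      by (auto simp: X_def)
    finally show ?thesis .
  qed
  have "lborel = N"
  proof (rule lborel_eqI)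
    fix l u :: real
    assume "\<And>b. b \<in> Basis \<Longrightarrow> l \<bullet> b \<le> u \<bullet> b"
    then have "l \<le> u" by simp
    then show "emeasure N (box l u) = ennreal (\<Prod>b\<in>Basis. (u - l) \<bullet> b)"
      using interval[of l u] by (simp add: N box_real)
  qed (simp add: N_def)
  have HA: "H -` A \<in> sets borel"
    using measurable_sets[OF H A] by simp
  have "emeasure lborel (H -` A) = emeasure M {x \<in> space M. T x \<in> D \<and> L (T x) \<in> H -` A}"
    using N[OF HA] \<open>lborel = N\<close> by metis
  also have "{x \<in> space M. T x \<in> D \<and> L (T x) \<in> H -` A} = T -` A \<inter> space M - T -` (space M - D) \<inter> space M"
    \<comment> \<open>\<open>N\<close> does not see the points that \<open>T\<close> sends outside
      \<open>D\<close>; on the rest, \<open>HL\<close> turns membership of \<open>L (T x)\<close> in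
      the preimage of \<open>A\<close> under \<open>H\<close> back into
      \<open>T x \<in> A\<close>.\<close>
    using measurable_space[OF T] HL by auto
  also have "emeasure M \<dots> = emeasure M (T -` A \<inter> space M)"
    using null by (rule emeasure_Diff_null_set) simp
  finally show ?thesis by simp
qed

section \<open>Angular and logarithmic coordinates; the branches as rotations\<close>

context
  fixes n :: nat
  assumes n: "n \<ge> 3"
begin

definition \<tau> :: real where
  "\<tau> = pi / (2 * real n)"

text \<open>The angular midpoint of the \<open>k\<close>-th interval and also the rotation angle of
  the \<open>k\<close>-th branch; \<open>\<tau>\<close> is the angular half-width of every
  interval.\<close>

definition \<psi> :: "nat \<Rightarrow> real" where
  "\<psi> k = 2 * \<tau> * real k"

text \<open>The arccotangent of \<open>t / (t_star n)\<^sup>2\<close> with values between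
  \<open>0\<close> and \<open>pi\<close>. It decreases in \<open>t\<close>, so passing to angles
  reverses the order.\<close>

definition angle :: "real \<Rightarrow> real" where
  "angle t = pi / 2 - arctan (t / (t_star n)\<^sup>2)"

text \<open>Inside the domain this is twice the inverse hyperbolic tangent of
  \<open>t / t_star n\<close>.\<close>

definition log_coord :: "real \<Rightarrow> real" where
  "log_coord t = ln (t_star n + t) - ln (t_star n - t)"

text \<open>The quotient of exponentials is the hyperbolic tangent of \<open>x / 2\<close>.\<close>

definition log_coord_inv :: "real \<Rightarrow> real" where
  "log_coord_inv x = t_star n * ((exp x - 1) / (exp x + 1))"

lemma tau_bounds: "0 < \<tau>" "\<tau> < pi / 4"
  using n by (auto simp: \<tau>_def field_simps)

lemma t_star_eq: "t_star n = tan \<tau>"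
  by (simp add: t_star_def \<tau>_def)

lemma t_star_pos: "0 < t_star n"
  unfolding t_star_eq using tau_bounds by (intro tan_gt_zero) auto

lemma psi_n: "\<psi> n = pi"
  using n by (simp add: \<psi>_def \<tau>_def)

lemma psi_Suc: "\<psi> (Suc k) = \<psi> k + 2 * \<tau>"
  by (simp add: \<psi>_def algebra_simps)

lemma coeff_eq: "a_coeff k n = cos (\<psi> k)" "b_coeff k n = sin (\<psi> k)"
  by (simp_all add: a_coeff_def b_coeff_def \<psi>_def \<tau>_def)

lemma cot_angle: "(t_star n)\<^sup>2 * cot (angle t) = t"
  using t_star_pos by (simp add: angle_def tan_cot' [symmetric] tan_arctan)

lemma angle_bounds: "0 < angle t" "angle t < pi"
  using arctan_lbound[of "t / (t_star n)\<^sup>2"] arctan_ubound[of "t / (t_star n)\<^sup>2"]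
  by (auto simp: angle_def)

lemma angle_cot:
  assumes "0 < x" "x < pi"
  shows "angle ((t_star n)\<^sup>2 * cot x) = x"
proof -
  have "arctan (tan (pi / 2 - x)) = pi / 2 - x"
    using assms by (intro arctan_tan) auto
  then show ?thesis
    using t_star_pos by (simp add: angle_def tan_cot')
qed

lemma angle_less_iff: "angle s < angle t \<longleftrightarrow> t < s"
  using t_star_pos by (simp add: angle_def arctan_less_iff divide_less_cancel)

lemma angle_le_iff: "angle s \<le> angle t \<longleftrightarrow> t \<le> s"
  using angle_less_iff[of t s] by auto

lemma le_cot_iff: "0 < x \<Longrightarrow> x < pi \<Longrightarrow> t \<le> (t_star n)\<^sup>2 * cot x \<longleftrightarrow> x \<le> angle t"
  and cot_le_iff: "0 < x \<Longrightarrow> x < pi \<Longrightarrow> (t_star n)\<^sup>2 * cot x \<le> t \<longleftrightarrow> angle t \<le> x"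
  by (metis angle_cot angle_le_iff)+

lemma less_cot_iff: "0 < x \<Longrightarrow> x < pi \<Longrightarrow> t < (t_star n)\<^sup>2 * cot x \<longleftrightarrow> x < angle t"
  and cot_less_iff: "0 < x \<Longrightarrow> x < pi \<Longrightarrow> (t_star n)\<^sup>2 * cot x < t \<longleftrightarrow> angle t < x"
  by (metis angle_cot angle_less_iff)+

lemma t_star_eq_cot: "t_star n = (t_star n)\<^sup>2 * cot \<tau>"
    "- t_star n = (t_star n)\<^sup>2 * cot (pi - \<tau>)"
  using t_star_pos by (simp_all add: t_star_eq cot_def tan_def power2_eq_square)

lemma domain_iff: "t \<in> {- t_star n .. t_star n} \<longleftrightarrow> angle t \<in> {\<tau> .. pi - \<tau>}"
  using le_cot_iff[of \<tau> t] cot_le_iff[of "pi - \<tau>" t] tau_bounds t_star_eq_cot by auto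

text \<open>Since \<open>\<psi> n = pi\<close>, each \<open>\<psi> k\<close> lies between
  \<open>2 * \<tau>\<close> and \<open>pi - 2 * \<tau>\<close>, which leaves room for a shift by
  \<open>\<tau>\<close> to either side.\<close>

lemma branch_bounds:
  assumes "k \<in> {1..n - 1}" "\<bar>x\<bar> \<le> \<tau>"
  shows "\<tau> \<le> x + \<psi> k" "x + \<psi> k \<le> pi - \<tau>" "0 < x + \<psi> k" "x + \<psi> k < pi"
proof -
  have "1 \<le> real k" "real k + 1 \<le> real n"
    using assms(1) by auto
  then have "2 * \<tau> * 1 \<le> 2 * \<tau> * real k" "2 * \<tau> * (real k + 1) \<le> 2 * \<tau> * real n"
    using tau_bounds by (intro mult_left_mono; simp)+
  then show "\<tau> \<le> x + \<psi> k" "x + \<psi> k \<le> pi - \<tau>"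
    using assms(2) psi_n by (auto simp: \<psi>_def distrib_left)
  then show "0 < x + \<psi> k" "x + \<psi> k < pi"
    using tau_bounds by linarith+
qed

lemma J_interval_iff:
  assumes "k \<in> {1..n - 1}"
  shows "t \<in> J_interval n k \<longleftrightarrow> \<bar>angle t - \<psi> k\<bar> \<le> \<tau>"
proof -
  have *: "pi * (2 * real k + 1) / (2 * real n) = \<tau> + \<psi> k"
       "pi * (2 * real k - 1) / (2 * real n) = - \<tau> + \<psi> k"
    using n by (auto simp: \<psi>_def \<tau>_def field_simps)
  show ?thesis
    using branch_bounds[OF assms, of \<tau>] branch_bounds[OF assms, of "-\<tau>"] tau_bounds
      le_cot_iff[of "-\<tau> + \<psi> k" t] cot_le_iff[of "\<tau> + \<psi> k" t]
    unfolding J_interval_def * atLeastAtMost_iff abs_le_iff by argo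
qed

text \<open>Substituting the cotangent for \<open>t\<close> turns numerator and denominator into the
  subtraction formulas for sine and cosine, with the common factor
  \<open>(t_star n)\<^sup>2 / sin x\<close>. Where the cosine vanishes, both sides take the default
  value \<open>0\<close>.\<close>

lemma F_branch_eq: "F_branch n k t = tan (angle t - \<psi> k)"
proof -
  define x where "x = angle t"
  have s: "sin x > 0"
    unfolding x_def using angle_bounds by (rule sin_gt_zero)
  have t: "t = (t_star n)\<^sup>2 * (cos x / sin x)"
    using cot_angle[of t] by (simp add: x_def cot_def)
  have "F_branch n k t = ((t_star n)\<^sup>2 / sin x * sin (x - \<psi> k)) / ((t_star n)\<^sup>2 / sin x * cos (x - \<psi> k))"
    unfolding F_branch_def coeff_eq sin_diff cos_diff
    by (subst (1 2) t) (use s in \<open>simp add: field_simps\<close>)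
  then show ?thesis
    using s t_star_pos by (simp add: tan_def x_def)
qed

text \<open>The midpoints are spaced \<open>2 * \<tau>\<close> apart, so an open arc around one of
  them misses the closed arcs around all others.\<close>

lemma branch_unique:
  assumes "\<bar>x - \<psi> k\<bar> < \<tau>" "\<bar>x - \<psi> j\<bar> \<le> \<tau>"
  shows "j = k"
proof -
  have "\<bar>2 * \<tau> * (real k - real j)\<bar> < 2 * \<tau> * 1"
    using assms unfolding \<psi>_def right_diff_distrib mult_1_right abs_less_iff abs_le_iff by argo
  then have "\<bar>real k - real j\<bar> < 1"
    using tau_bounds(1) unfolding abs_mult by (subst (asm) abs_of_pos) auto
  then show ?thesis by linarith
qed

section \<open>The measure \<open>mu n\<close> in the logarithmic coordinate\<close>

lemma space_mu [simp]: "space (mu n) = {- t_star n .. t_star n}"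
  by (simp add: mu_def space_restrict_space)

lemma sets_mu: "sets (mu n) = sets (restrict_space borel {- t_star n .. t_star n})"
  by (simp add: mu_def) (metis sets_lborel sets_restrict_space_cong)

lemma sets_mu_iff: "A \<in> sets (mu n) \<longleftrightarrow> A \<in> sets borel \<and> A \<subseteq> {- t_star n .. t_star n}"
  unfolding sets_mu by (subst sets_restrict_space_iff) auto

lemma rho_measurable [measurable]: "rho n \<in> borel_measurable borel"
  unfolding rho_def by measurable

lemma emeasure_mu:
  assumes "A \<in> sets borel" "A \<subseteq> {- t_star n .. t_star n}"
  shows "emeasure (mu n) A = (\<integral>\<^sup>+ t. ennreal (rho n t) * indicator A t \<partial>lborel)"
proof -
  have "emeasure (mu n) A = (\<integral>\<^sup>+ t. ennreal (rho n t) * indicator A t \<partial>restrict_space lborel {- t_star n .. t_star n})"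
    unfolding mu_def using assms
    by (intro emeasure_density) (auto simp: sets_restrict_space_iff intro!: measurable_restrict_space1)
  also have "\<dots> = (\<integral>\<^sup>+ t. ennreal (rho n t) * indicator A t * indicator {- t_star n .. t_star n} t \<partial>lborel)"
    by (rule nn_integral_restrict_space) simp
  also have "\<dots> = (\<integral>\<^sup>+ t. ennreal (rho n t) * indicator A t \<partial>lborel)"
    using assms(2) by (intro nn_integral_cong) (auto split: split_indicator)
  finally show ?thesis .
qed

lemma finite_null_sets_mu:
  assumes "finite A" "A \<subseteq> {- t_star n .. t_star n}"
  shows "A \<in> null_sets (mu n)"
proof -
  have A: "A \<in> sets borel"
    using assms(1) by (intro borel_closed finite_imp_closed)
  have "emeasure (mu n) A = (\<integral>\<^sup>+ t. 0 \<partial>(lborel :: real measure))"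
    unfolding emeasure_mu[OF A assms(2)]
  proof (rule nn_integral_cong_AE)
    have "A \<in> null_sets lborel" using assms(1) by (rule finite_imp_null_set_lborel)
    then have "AE t in lborel. t \<notin> A" by (rule AE_not_in)
    then show "AE t in lborel. ennreal (rho n t) * indicator A t = 0"
      by eventually_elim simp
  qed
  then show ?thesis using A assms(2) by (simp add: null_sets_def sets_mu_iff)
qed

lemma emeasure_mu_interval:
  assumes "- t_star n < a" "a \<le> b" "b < t_star n"
  shows "emeasure (mu n) {a<..<b} = ennreal (log_coord b - log_coord a)"
proof -
  have bd: "\<bar>t\<bar> < t_star n" if "t \<in> {a..b}" for t
    using that assms by auto
  have pos: "(t_star n)\<^sup>2 - t\<^sup>2 = (t_star n - t) * (t_star n + t)" for t
    by (simp add: power2_eq_square algebra_simps)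
  have "emeasure (mu n) {a<..<b} = (\<integral>\<^sup>+ t. ennreal (rho n t) * indicator {a<..<b} t \<partial>lborel)"
    using assms by (intro emeasure_mu) auto
  \<comment> \<open>Adding two null points gives a compact interval inside the open domain, away
    from the singularities of the density, and the fundamental theorem of calculus applies.\<close>
  also have "\<dots> = (\<integral>\<^sup>+ t. ennreal (rho n t) * indicator {a..b} t \<partial>lborel)"
  proof (rule nn_integral_cong_AE)
    show "AE t in lborel. ennreal (rho n t) * indicator {a<..<b} t = ennreal (rho n t) * indicator {a..b} t"
      using AE_lborel_singleton[of a] AE_lborel_singleton[of b]
      by eventually_elim (auto split: split_indicator)
  qed
  also have "\<dots> = ennreal (log_coord b - log_coord a)"
  proof (rule nn_integral_FTC_Icc)
    show "rho n \<in> borel_measurable borel" by measurable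
    fix t assume t: "t \<in> {a..b}"
    note bd = bd[OF t]
    show "0 \<le> rho n t"
      unfolding rho_def pos using bd by (intro divide_nonneg_nonneg mult_nonneg_nonneg) auto
    show "(log_coord has_field_derivative rho n t) (at t)"
      unfolding log_coord_def[abs_def] rho_def pos using bd
      by (auto intro!: derivative_eq_intros simp: field_simps)
  qed (use assms in auto)
  finally show ?thesis .
qed

lemma log_coord_of_inv: "log_coord (log_coord_inv x) = x"
proof -
  have p: "exp x + 1 > 0" by (simp add: add_pos_pos)
  \<comment> \<open>Both right-hand sides show the same factor, and the trailing \<open>* 1\<close>
    keeps the product shape that \<open>ln_mult_diff\<close> matches.\<close>
  then have *: "t_star n + log_coord_inv x = 2 * t_star n / (exp x + 1) * exp x"
      "t_star n - log_coord_inv x = 2 * t_star n / (exp x + 1) * 1"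
    unfolding log_coord_inv_def by (auto simp: field_simps)
  have "2 * t_star n / (exp x + 1) > 0"
    using p t_star_pos by simp
  then show ?thesis
    unfolding log_coord_def * by (subst ln_mult_diff) simp_all
qed

lemma log_coord_inv_bounds: "log_coord_inv x \<in> {- t_star n <..< t_star n}"
proof -
  have p: "exp x + 1 > 0" by (simp add: add_pos_pos)
  have "-1 < (exp x - 1) / (exp x + 1)" "(exp x - 1) / (exp x + 1) < 1"
    using p by (auto simp: field_simps)
  then have "t_star n * (-1) < log_coord_inv x" "log_coord_inv x < t_star n * 1"
    unfolding log_coord_inv_def using t_star_pos by (intro mult_strict_left_mono; simp)+
  then show ?thesis by simp
qed

lemma log_coord_inv_of:
  assumes "y \<in> {- t_star n <..< t_star n}"
  shows "log_coord_inv (log_coord y) = y"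
proof -
  have "exp (log_coord y) = (t_star n + y) / (t_star n - y)"
    using assms by (simp add: log_coord_def exp_diff)
  then have "exp (log_coord y) - 1 = 2 * y / (t_star n - y)" "exp (log_coord y) + 1 = 2 * t_star n / (t_star n - y)"
    using assms by (simp_all add: field_simps)
  then show ?thesis
    using assms t_star_pos by (simp add: log_coord_inv_def)
qed

lemma log_coord_strict_mono:
  assumes "- t_star n < x" "x < y" "y < t_star n"
  shows "log_coord x < log_coord y"
proof -
  have "ln (t_star n + x) < ln (t_star n + y)" "ln (t_star n - y) < ln (t_star n - x)"
    using assms by simp_all
  then show ?thesis by (simp add: log_coord_def)
qed

lemma log_coord_in_interval_iff:
  assumes "y \<in> {- t_star n <..< t_star n}"
  shows "log_coord y \<in> {l<..<u} \<longleftrightarrow> y \<in> {log_coord_inv l<..<log_coord_inv u}"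
proof -
  have iff: "log_coord x < log_coord z \<longleftrightarrow> x < z"
    if "x \<in> {- t_star n <..< t_star n}" "z \<in> {- t_star n <..< t_star n}" for x z
    using that log_coord_strict_mono[of x z] log_coord_strict_mono[of z x] by (cases x z rule: linorder_cases) auto
  show ?thesis
    using iff[OF log_coord_inv_bounds[of l] assms] iff[OF assms log_coord_inv_bounds[of u]] by (simp add: log_coord_of_inv)
qed

text \<open>Here \<open>D\<close> is the open domain, on which \<open>log_coord\<close> is an
  increasing bijection onto the line. The assumption \<open>null\<close> disposes of the points sent
  to the ends \<open>- t_star n\<close> and \<open>t_star n\<close>, where the coordinate is
  singular.\<close>

lemma emeasure_mu_vimage:
  assumes T: "T \<in> measurable (mu n) (mu n)"
    and null: "finite {t \<in> {- t_star n .. t_star n}. T t \<in> {- t_star n, t_star n}}"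
    and interval: "\<And>a b. - t_star n < a \<Longrightarrow> a \<le> b \<Longrightarrow> b < t_star n \<Longrightarrow>
      emeasure (mu n) {t \<in> {- t_star n .. t_star n}. T t \<in> {a<..<b}} = ennreal (log_coord b - log_coord a)"
    and A: "A \<in> sets (mu n)"
  shows "emeasure (mu n) (T -` A \<inter> space (mu n)) = emeasure lborel (log_coord_inv -` A)"
proof (rule emeasure_vimage_eq_lborel[OF T, where D = "{- t_star n <..< t_star n}" and L = log_coord])
  show "{- t_star n<..<t_star n} \<in> sets (mu n)" by (auto simp: sets_mu_iff)
  show "log_coord \<in> borel_measurable (restrict_space (mu n) {- t_star n<..<t_star n})"
  proof (rule measurable_restrict_space1)
    have "log_coord \<in> borel_measurable (restrict_space borel {- t_star n .. t_star n})"
      unfolding log_coord_def by (intro measurable_restrict_space1) measurable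
    then show "log_coord \<in> borel_measurable (mu n)"
      by (simp add: measurable_cong_sets[OF sets_mu refl])
  qed
  have "log_coord_inv \<in> measurable borel (restrict_space borel {- t_star n .. t_star n})"
  proof (rule measurable_restrict_space2)
    show "log_coord_inv \<in> space borel \<rightarrow> {- t_star n .. t_star n}"
      using log_coord_inv_bounds by (auto simp: less_imp_le)
  qed (unfold log_coord_inv_def, measurable)
  then show "log_coord_inv \<in> measurable borel (mu n)"
    by (simp add: measurable_cong_sets[OF refl sets_mu])
  have "T -` (space (mu n) - {- t_star n<..<t_star n}) \<inter> space (mu n) =
      {t \<in> {- t_star n .. t_star n}. T t \<in> {- t_star n, t_star n}}"
    using t_star_pos by auto
  then show "T -` (space (mu n) - {- t_star n<..<t_star n}) \<inter> space (mu n) \<in> null_sets (mu n)"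
    using finite_null_sets_mu[OF null] by auto
  fix l u :: real assume "l \<le> u"
  have "log_coord_inv l \<le> log_coord_inv u"
    using log_coord_strict_mono[of "log_coord_inv u" "log_coord_inv l"] log_coord_inv_bounds[of l] log_coord_inv_bounds[of u] \<open>l \<le> u\<close> by (fastforce simp: log_coord_of_inv)
  have "{t \<in> space (mu n). T t \<in> {- t_star n<..<t_star n} \<and> log_coord (T t) \<in> {l<..<u}} =
      {t \<in> {- t_star n .. t_star n}. T t \<in> {log_coord_inv l<..<log_coord_inv u}}"
    using log_coord_in_interval_iff[of _ l u] log_coord_inv_bounds[of l] log_coord_inv_bounds[of u] unfolding space_mu by fastforce
  then show "emeasure (mu n) {t \<in> space (mu n). T t \<in> {- t_star n<..<t_star n} \<and> log_coord (T t) \<in> {l<..<u}}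
      = ennreal (u - l)"
    using interval[OF _ \<open>log_coord_inv l \<le> log_coord_inv u\<close>] log_coord_inv_bounds[of l] log_coord_inv_bounds[of u] by (simp add: log_coord_of_inv)
qed (use log_coord_inv_bounds log_coord_of_inv log_coord_inv_of A in auto)

lemma emeasure_mu_eq_lborel:
  assumes "A \<in> sets (mu n)"
  shows "emeasure (mu n) A = emeasure lborel (log_coord_inv -` A)"
proof -
  have "emeasure (mu n) ((\<lambda>t. t) -` A \<inter> space (mu n)) = emeasure lborel (log_coord_inv -` A)"
  proof (rule emeasure_mu_vimage[OF _ _ _ assms])
    fix a b :: real assume "- t_star n < a" "a \<le> b" "b < t_star n"
    moreover from this have "{t \<in> {- t_star n .. t_star n}. t \<in> {a<..<b}} = {a<..<b}"
      by auto
    ultimately show "emeasure (mu n) {t \<in> {- t_star n .. t_star n}. t \<in> {a<..<b}} = ennreal (log_coord b - log_coord a)"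
      using emeasure_mu_interval by presburger
  qed auto
  moreover have "(\<lambda>t. t) -` A \<inter> space (mu n) = A"
    using sets.sets_into_space[OF assms] by auto
  ultimately show ?thesis by simp
qed

text \<open>A finite-valued density over a sigma-finite measure keeps it sigma-finite, even though
  this one is unbounded near the ends of the domain.\<close>

lemma sigma_finite_mu: "sigma_finite_measure (mu n)"
proof -
  interpret sigma_finite_measure "restrict_space lborel {- t_star n .. t_star n}"
    by (rule sigma_finite_measure_restrict_space[OF lborel.sigma_finite_measure_axioms]) simp
  show ?thesis
    unfolding mu_def
    by (subst sigma_finite_iff_density_finite) (auto intro!: measurable_restrict_space1)
qed

section \<open>Telescoping of the logarithmic coordinate over the branches\<close>

lemma log_coord_cot:
  assumes "\<tau> < x" "x < pi - \<tau>"
  shows "log_coord ((t_star n)\<^sup>2 * cot x) = ln (sin (x + \<tau>)) - ln (sin (x - \<tau>))"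
proof -
  define T where "T = t_star n"
  have pos: "sin x > 0" "sin (x + \<tau>) > 0" "sin (x - \<tau>) > 0" "cos \<tau> > 0" "T > 0"
    using assms tau_bounds t_star_pos unfolding T_def
    by (auto intro!: sin_gt_zero cos_gt_zero)
  have T: "T * cos \<tau> = sin \<tau>"
    using pos(4) by (simp add: T_def t_star_eq tan_def)
  \<comment> \<open>Keeping \<open>T * cos \<tau>\<close> together lets it be replaced by
    \<open>sin \<tau>\<close>, after which the bracket is the addition formula for sine. The factor
    in front is the same for plus and minus and cancels between the logarithms.\<close>
  have "T + T\<^sup>2 * cot x = T / (sin x * cos \<tau>) * (sin x * cos \<tau> + cos x * (T * cos \<tau>))"
    using pos by (simp add: cot_def field_simps power2_eq_square)
  then have 1: "T + T\<^sup>2 * cot x = T / (sin x * cos \<tau>) * sin (x + \<tau>)"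
    by (simp only: T sin_add)
  have "T - T\<^sup>2 * cot x = T / (sin x * cos \<tau>) * (sin x * cos \<tau> - cos x * (T * cos \<tau>))"
    using pos by (simp add: cot_def field_simps power2_eq_square)
  then have 2: "T - T\<^sup>2 * cot x = T / (sin x * cos \<tau>) * sin (x - \<tau>)"
    by (simp only: T sin_diff)
  have "T / (sin x * cos \<tau>) > 0"
    using pos by simp
  then show ?thesis
    using pos unfolding log_coord_def T_def[symmetric] 1 2 by (intro ln_mult_diff)
qed

lemma log_coord_tan:
  assumes "\<bar>x\<bar> < \<tau>"
  shows "log_coord (tan x) = ln (sin (\<tau> + x)) - ln (sin (\<tau> - x))"
proof -
  have pos: "cos x > 0" "cos \<tau> > 0" "sin (\<tau> + x) > 0" "sin (\<tau> - x) > 0"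
    using assms tau_bounds
    by (auto intro!: sin_gt_zero cos_gt_zero_pi simp: abs_less_iff)
  have 1: "t_star n + tan x = 1 / (cos x * cos \<tau>) * sin (\<tau> + x)"
    using pos by (simp add: t_star_eq tan_def sin_add field_simps)
  have 2: "t_star n - tan x = 1 / (cos x * cos \<tau>) * sin (\<tau> - x)"
    using pos by (simp add: t_star_eq tan_def sin_diff field_simps)
  have "1 / (cos x * cos \<tau>) > 0"
    using pos by simp
  then show ?thesis
    using pos unfolding log_coord_def 1 2 by (intro ln_mult_diff)
qed

text \<open>The minus sign reflects that every branch is decreasing: its preimage of
  \<open>tan x\<close> moves down as \<open>x\<close> grows.\<close>

lemma sum_log_coord_branches:
  assumes "\<bar>x\<bar> < \<tau>"
  shows "(\<Sum>k = 1..n - 1. log_coord ((t_star n)\<^sup>2 * cot (x + \<psi> k))) = - log_coord (tan x)"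
proof -
  define g where "g k = ln (sin (x + \<psi> k - \<tau>))" for k
  \<comment> \<open>Adjacent arcs abut, so the positive term of branch \<open>k\<close> is the
    negative term of branch \<open>Suc k\<close>.\<close>
  have shift: "x + \<psi> k + \<tau> = x + \<psi> (Suc k) - \<tau>" for k
    by (simp add: psi_Suc)
  have "log_coord ((t_star n)\<^sup>2 * cot (x + \<psi> k)) = g (Suc k) - g k" if "k \<in> {1..n - 1}" for k
  proof -
    have "\<tau> < x + \<psi> k" "x + \<psi> k < pi - \<tau>"
      using branch_bounds[OF that, of \<tau>] branch_bounds[OF that, of "- \<tau>"] assms tau_bounds
      by (auto simp: abs_less_iff)
    then show ?thesis
      by (simp only: log_coord_cot g_def shift)
  qed
  then have "(\<Sum>k = 1..n - 1. log_coord ((t_star n)\<^sup>2 * cot (x + \<psi> k))) = (\<Sum>k = 1..n - 1. g (Suc k) - g k)"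
    by simp
  also have "\<dots> = g n - g 1"
    using n sum_Suc_diff[of 1 "n - 1" g] by simp
  also have "g n = ln (sin (\<tau> - x))"
  proof -
    have "x + \<psi> n - \<tau> = pi - (\<tau> - x)" by (simp add: psi_n)
    then show ?thesis unfolding g_def by (simp only: sin_pi_minus)
  qed
  also have "g 1 = ln (sin (\<tau> + x))"
  proof -
    have "x + \<psi> 1 - \<tau> = \<tau> + x" by (simp add: \<psi>_def)
    then show ?thesis unfolding g_def by (simp only:)
  qed
  finally show ?thesis
    by (simp add: log_coord_tan[OF assms])
qed

section \<open>Invariance for an arbitrary choice of the map at the common endpoints\<close>

context
  fixes F :: "real \<Rightarrow> real"
  assumes F: "is_F_map n F"
begin

lemma F_cases:
  assumes "t \<in> {- t_star n .. t_star n}"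
  obtains k where "k \<in> {1..n - 1}" "\<bar>angle t - \<psi> k\<bar> \<le> \<tau>" "F t = tan (angle t - \<psi> k)"
  using F assms J_interval_iff F_branch_eq unfolding is_F_map_def by metis

lemma F_in_domain:
  assumes "t \<in> {- t_star n .. t_star n}"
  shows "F t \<in> {- t_star n .. t_star n}"
proof -
  from F_cases[OF assms] obtain k where "\<bar>angle t - \<psi> k\<bar> \<le> \<tau>" "F t = tan (angle t - \<psi> k)" .
  then show ?thesis
    using tan_mono_le[of "angle t - \<psi> k" \<tau>] tan_mono_le[of "- \<tau>" "angle t - \<psi> k"] tau_bounds
    by (auto simp: t_star_eq abs_le_iff)
qed

text \<open>In an open arc \<open>branch_unique\<close> leaves only one candidate branch, so the
  freedom of choice in \<open>F\<close> has no effect there.\<close>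

lemma F_interior:
  assumes "k \<in> {1..n - 1}" "\<bar>angle t - \<psi> k\<bar> < \<tau>"
  shows "t \<in> {- t_star n .. t_star n}" "F t = tan (angle t - \<psi> k)"
proof -
  show t: "t \<in> {- t_star n .. t_star n}"
    using branch_bounds[OF assms(1), of "angle t - \<psi> k"] assms(2) unfolding domain_iff by simp
  from F_cases[OF t] obtain j where "\<bar>angle t - \<psi> j\<bar> \<le> \<tau>" "F t = tan (angle t - \<psi> j)" .
  with branch_unique[OF assms(2)] show "F t = tan (angle t - \<psi> k)" by auto
qed

text \<open>In angles these are the odd multiples of \<open>\<tau>\<close> from
  \<open>\<tau>\<close> to \<open>pi - \<tau>\<close>: the points shared by adjacent intervals and
  the two ends of the domain.\<close>

definition endpoints :: "real set" where
  "endpoints = (\<Union>k\<in>{1..n - 1}. {t. \<bar>angle t - \<psi> k\<bar> = \<tau>})"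

lemma finite_endpoints: "finite endpoints"
proof -
  have "{t. \<bar>angle t - \<psi> k\<bar> = \<tau>} \<subseteq> (\<lambda>x. (t_star n)\<^sup>2 * cot x) ` {\<psi> k + \<tau>, \<psi> k - \<tau>}" for k
  proof
    fix t assume "t \<in> {t. \<bar>angle t - \<psi> k\<bar> = \<tau>}"
    then have "angle t \<in> {\<psi> k + \<tau>, \<psi> k - \<tau>}" by (auto simp: abs_if split: if_splits)
    then show "t \<in> (\<lambda>x. (t_star n)\<^sup>2 * cot x) ` {\<psi> k + \<tau>, \<psi> k - \<tau>}"
      by (intro image_eqI[where x = "angle t"]) (simp_all only: cot_angle)
  qed
  then have "finite {t. \<bar>angle t - \<psi> k\<bar> = \<tau>}" for k
    by (rule finite_subset) simp
  then show ?thesis by (simp add: endpoints_def)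
qed

lemma F_measurable: "F \<in> measurable (mu n) (mu n)"
proof -
  \<comment> \<open>The open arcs are disjoint, so at most one guard holds and the sum acts as a
    definition by cases. On the domain \<open>G\<close> can differ from \<open>F\<close> only at the
    finitely many \<open>endpoints\<close>, which does not affect measurability.\<close>
  define G where "G t = (\<Sum>k = 1..n - 1. if \<bar>angle t - \<psi> k\<bar> < \<tau> then F_branch n k t else 0)" for t
  have [measurable]: "angle \<in> borel_measurable borel"
    unfolding angle_def by measurable
  have [measurable]: "F_branch n k \<in> borel_measurable borel" for k
    unfolding F_branch_def by measurable
  have "F \<in> measurable (restrict_space borel {- t_star n .. t_star n}) borel"
  proof (rule measurable_discrete_difference[where X = "endpoints \<inter> {- t_star n .. t_star n}"])
    show "G \<in> measurable (restrict_space borel {- t_star n .. t_star n}) borel"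
      unfolding G_def by (intro measurable_restrict_space1) measurable
    show "countable (endpoints \<inter> {- t_star n .. t_star n})"
      using finite_endpoints by (simp add: countable_finite)
    fix t assume "t \<in> space (restrict_space borel {- t_star n .. t_star n})"
      and "t \<notin> endpoints \<inter> {- t_star n .. t_star n}"
    then have t: "t \<in> {- t_star n .. t_star n}" "t \<notin> endpoints"
      by (auto simp: space_restrict_space)
    obtain k where k: "k \<in> {1..n - 1}" "\<bar>angle t - \<psi> k\<bar> \<le> \<tau>" "F t = tan (angle t - \<psi> k)"
      by (rule F_cases[OF t(1)])
    with t(2) have less: "\<bar>angle t - \<psi> k\<bar> < \<tau>"
      unfolding endpoints_def by force
    have "G t = (\<Sum>j = 1..n - 1. if k = j then F_branch n j t else 0)"
      unfolding G_def using branch_unique[OF less] less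
      by (intro sum.cong refl if_cong) force+
    also have "\<dots> = F_branch n k t"
      using k(1) by simp
    finally show "G t = F t"
      by (simp only: k(3) F_branch_eq)
  qed (auto simp: sets_restrict_space_iff)
  then have "F \<in> measurable (restrict_space borel {- t_star n .. t_star n}) (restrict_space borel {- t_star n .. t_star n})"
    by (rule measurable_restrict_space2[rotated]) (auto simp: space_restrict_space dest!: F_in_domain[simplified])
  then show ?thesis
    by (simp add: measurable_cong_sets[OF sets_mu sets_mu])
qed

text \<open>Tangent is injective on the closed arc from \<open>- \<tau>\<close> to
  \<open>\<tau>\<close>, so the values \<open>- t_star n\<close> and \<open>t_star n\<close> are
  taken only at arc ends.\<close>

lemma finite_F_boundary: "finite {t \<in> {- t_star n .. t_star n}. F t \<in> {- t_star n, t_star n}}"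
proof (rule finite_subset[OF _ finite_endpoints], rule subsetI)
  fix t assume "t \<in> {t \<in> {- t_star n .. t_star n}. F t \<in> {- t_star n, t_star n}}"
  then have t: "t \<in> {- t_star n .. t_star n}" and Ft: "F t = tan (- \<tau>) \<or> F t = tan \<tau>"
    by (auto simp: t_star_eq)
  obtain k where k: "k \<in> {1..n - 1}" "\<bar>angle t - \<psi> k\<bar> \<le> \<tau>" "F t = tan (angle t - \<psi> k)"
    by (rule F_cases[OF t])
  have "angle t - \<psi> k = arctan (F t)"
    using k(2) tau_bounds unfolding k(3) by (intro arctan_tan[symmetric]) (auto simp: abs_le_iff)
  also have "\<dots> = - \<tau> \<or> \<dots> = \<tau>"
    using Ft tau_bounds arctan_tan[of \<tau>] arctan_tan[of "- \<tau>"] by auto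
  finally have "\<bar>angle t - \<psi> k\<bar> = \<tau>" using tau_bounds by auto
  then show "t \<in> endpoints" using k(1) by (auto simp: endpoints_def)
qed

text \<open>On each closed arc \<open>F\<close> is the increasing tangent of the shifted angle.
  Strict bounds on \<open>x\<close> and \<open>y\<close> keep the arc ends out, so the choice of
  branch there is immaterial; the cotangent swaps the ends.\<close>

lemma vimage_F_interval:
  assumes "- \<tau> < x" "x \<le> y" "y < \<tau>"
  shows "{t \<in> {- t_star n .. t_star n}. F t \<in> {tan x<..<tan y}} =
    (\<Union>k\<in>{1..n - 1}. {(t_star n)\<^sup>2 * cot (y + \<psi> k)<..<(t_star n)\<^sup>2 * cot (x + \<psi> k)})"
proof -
  have tan_iff: "tan s \<in> {tan x<..<tan y} \<longleftrightarrow> s \<in> {x<..<y}" if "\<bar>s\<bar> \<le> \<tau>" for s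
    using that assms tau_bounds by (auto simp: tan_mono_lt_eq abs_le_iff)
  have iff: "t \<in> {(t_star n)\<^sup>2 * cot (y + \<psi> k)<..<(t_star n)\<^sup>2 * cot (x + \<psi> k)} \<longleftrightarrow>
      angle t - \<psi> k \<in> {x<..<y}" if "k \<in> {1..n - 1}" for k t
    using less_cot_iff[of "x + \<psi> k" t] cot_less_iff[of "y + \<psi> k" t] assms tau_bounds
      branch_bounds[OF that, of x] branch_bounds[OF that, of y] by auto
  show ?thesis
  proof (intro set_eqI iffI)
    fix t assume "t \<in> {t \<in> {- t_star n .. t_star n}. F t \<in> {tan x<..<tan y}}"
    then have t: "t \<in> {- t_star n .. t_star n}" "F t \<in> {tan x<..<tan y}" by auto
    obtain k where "k \<in> {1..n - 1}" "\<bar>angle t - \<psi> k\<bar> \<le> \<tau>" "F t = tan (angle t - \<psi> k)"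
      by (rule F_cases[OF t(1)])
    then show "t \<in> (\<Union>k\<in>{1..n - 1}. {(t_star n)\<^sup>2 * cot (y + \<psi> k)<..<(t_star n)\<^sup>2 * cot (x + \<psi> k)})"
      using t(2) iff tan_iff by (metis UN_I)
  next
    fix t assume "t \<in> (\<Union>k\<in>{1..n - 1}. {(t_star n)\<^sup>2 * cot (y + \<psi> k)<..<(t_star n)\<^sup>2 * cot (x + \<psi> k)})"
    then obtain k where k: "k \<in> {1..n - 1}" "angle t - \<psi> k \<in> {x<..<y}"
      using iff by blast
    then have "\<bar>angle t - \<psi> k\<bar> < \<tau>" using assms by auto
    with F_interior[OF k(1)] tan_iff[of "angle t - \<psi> k"] k(2)
    show "t \<in> {t \<in> {- t_star n .. t_star n}. F t \<in> {tan x<..<tan y}}" by auto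
  qed
qed

lemma emeasure_vimage_F_interval:
  assumes "- t_star n < a" "a \<le> b" "b < t_star n"
  shows "emeasure (mu n) {t \<in> {- t_star n .. t_star n}. F t \<in> {a<..<b}} = ennreal (log_coord b - log_coord a)"
proof -
  define x where "x = arctan a"
  define y where "y = arctan b"
  have ab: "a = tan x" "b = tan y" by (simp_all add: x_def y_def tan_arctan)
  have at: "arctan (t_star n) = \<tau>" unfolding t_star_eq
    using tau_bounds by (intro arctan_tan) auto
  have xy: "- \<tau> < x" "x \<le> y" "y < \<tau>"
    using assms arctan_less_iff[of "- t_star n" a] arctan_less_iff[of b "t_star n"] at
    by (auto simp: x_def y_def arctan_minus arctan_le_iff)
  define c where "c z k = (t_star n)\<^sup>2 * cot (z + \<psi> k)" for z k
  have bnd: "\<bar>x\<bar> < \<tau>" "\<bar>y\<bar> < \<tau>" using xy by auto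
  have c_less: "- t_star n < c z k" "c z k < t_star n"
    if "k \<in> {1..n - 1}" "\<bar>z\<bar> < \<tau>" for z k
  proof -
    have "\<tau> < z + \<psi> k" "z + \<psi> k < pi - \<tau>"
      using branch_bounds[OF that(1), of \<tau>] branch_bounds[OF that(1), of "- \<tau>"] that(2) tau_bounds
      by (auto simp: abs_less_iff)
    then show "- t_star n < c z k" "c z k < t_star n"
      using tau_bounds less_cot_iff[of "z + \<psi> k" "- t_star n"] cot_less_iff[of "z + \<psi> k" "t_star n"]
        angle_cot[of \<tau>] angle_cot[of "pi - \<tau>"] t_star_eq_cot
      by (auto simp: c_def)
  qed
  have c_angle: "angle (c z k) = z + \<psi> k" if "k \<in> {1..n - 1}" "\<bar>z\<bar> < \<tau>" for z k
    unfolding c_def using branch_bounds[OF that(1), of z] that(2) by (intro angle_cot) auto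
  have c_le: "c y k \<le> c x k" if "k \<in> {1..n - 1}" for k
    using angle_le_iff[of "c x k" "c y k"] xy c_angle[OF that] bnd by simp
  \<comment> \<open>A common point would have its angle in two different open arcs, against
    \<open>branch_unique\<close>.\<close>
  have "disjoint_family_on (\<lambda>k. {c y k<..<c x k}) {1..n - 1}"
    unfolding disjoint_family_on_def
  proof (intro ballI impI, rule ccontr)
    fix k j assume kj: "k \<in> {1..n - 1}" "j \<in> {1..n - 1}" "k \<noteq> j"
      and "{c y k<..<c x k} \<inter> {c y j<..<c x j} \<noteq> {}"
    then obtain t where t: "t \<in> {c y k<..<c x k}" "t \<in> {c y j<..<c x j}" by blast
    have "\<bar>angle t - \<psi> i\<bar> < \<tau>" if "t \<in> {c y i<..<c x i}" "i \<in> {1..n - 1}" for i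
      using that angle_less_iff[of t "c y i"] angle_less_iff[of "c x i" t] c_angle[OF that(2)] bnd
      by (auto simp: abs_less_iff)
    from branch_unique[OF this[OF t(1) kj(1)] less_imp_le[OF this[OF t(2) kj(2)]]] kj(3)
    show False by simp
  qed
  then have "emeasure (mu n) (\<Union>k\<in>{1..n - 1}. {c y k<..<c x k}) = (\<Sum>k = 1..n - 1. emeasure (mu n) {c y k<..<c x k})"
    using c_less bnd by (intro sum_emeasure[symmetric]) (fastforce simp: sets_mu_iff)+
  also have "\<dots> = (\<Sum>k = 1..n - 1. ennreal (log_coord (c x k) - log_coord (c y k)))"
    using c_less c_le bnd by (intro sum.cong refl emeasure_mu_interval) auto
  also have "\<dots> = ennreal (\<Sum>k = 1..n - 1. log_coord (c x k) - log_coord (c y k))"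
  proof (rule sum_ennreal)
    fix k assume "k \<in> {1..n - 1}"
    then show "0 \<le> log_coord (c x k) - log_coord (c y k)"
      using log_coord_strict_mono[of "c y k" "c x k"] c_less c_le bnd by (cases "c y k = c x k") force+
  qed
  \<comment> \<open>The upper ends \<open>c x k\<close> come from the lower end \<open>a\<close>, so
    the minus sign of the telescoped sum restores the order.\<close>
  also have "(\<Sum>k = 1..n - 1. log_coord (c x k) - log_coord (c y k)) = log_coord b - log_coord a"
    unfolding c_def sum_subtractf sum_log_coord_branches[OF bnd(1)] sum_log_coord_branches[OF bnd(2)] ab by simp
  finally show ?thesis
    unfolding ab vimage_F_interval[OF xy] c_def .
qed

text \<open>Both measures to be compared equal the Lebesgue measure of the preimage of
  \<open>A\<close> under \<open>log_coord_inv\<close>.\<close>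

lemma invariant_measure_F: "invariant_measure (mu n) F"
  unfolding invariant_measure_def
  using sigma_finite_mu F_measurable emeasure_mu_eq_lborel
    emeasure_mu_vimage[OF F_measurable finite_F_boundary emeasure_vimage_F_interval]
  by simp

end

end

theorem theorem1:
  fixes n :: nat and F :: "real \<Rightarrow> real"
  assumes "n \<ge> 3"
    and "is_F_map n F"
  shows "invariant_measure (mu n) F"
  using assms by (rule invariant_measure_F)

end
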